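(* Let $V:\mathbb{R}^2\to\mathbb{R}$ and $W:\mathbb{R}^2\to\mathbb{R}$ be functions with $W(x,y)=W(-x,-y)$ for all $(x,y)$, and let $\Omega=[a,b]\times[c,d]$ be partitioned by a (possibly nonuniform) Cartesian mesh as in the context. For a time step $\tau>0$, consider the fully discrete scheme which computes $\rho^{n+1}=\{\rho^{n+1}_{i,j}\}$ from $\rho^n$ by $$\frac{\rho^{n+1}_{i,j}-\rho^n_{i,j}}{\tau}=\frac{C^{n,*}_{i+1/2,j}-C^{n,*}_{i-1/2,j}}{h^x_i}+\frac{C^{n,*}_{i,j+1/2}-C^{n,*}_{i,j-1/2}}{h^y_j},\qquad 1\le i\le N_x,\ 1\le j\le N_y,$$ with the fluxes defined in the context. Then: (1) Conservation of mass: if $\rho^0_{i,j}=\frac1{|I_{i,j}|}\int_{I_{i,j}}\rho_0(x,y)\,dx\,dy$ for all $i,j$, where $\rho_0$ is the (integrable) initial datum on $\Omega$, then $$\sum_{i=1}^{N_x}\sum_{j=1}^{N_y}h^x_ih^y_j\rho^n_{i,j}=\int_\Omega\rho_0(x,y)\,dx\,dy\qquad\text{for all } n\ge1.$$ (2) Positivity preserving (for every $\tau>0$): if $\rho^n_{i,j}\ge0$ for all $i\in\{1,\dots,N_x\}$ and $j\in\{1,\dots,N_y\}$, then $\rho^{n+1}_{i,j}\ge0$ for all $i,j$. (3) Entropy dissipation: let $\rho^n$ be given with $\rho^n_{i,j}\ge0$ for all $i,j$ and $\rho^n\ne0$. There exists $\tau^*>0$ such that if $\tau\in(0,\tau^*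 )$, then $$E_h^{n+1}-E_h^n\le-\frac{\tau}{2}I_h^n,$$ where $$I_h^n=\sum_{j=1}^{N_y}\sum_{i=1}^{N_x-1}h^y_jC^{n,*}_{i+1/2,j}\left(\log\frac{\rho^{n+1}_{i+1,j}}{M^n_{i+1,j}}-\log\frac{\rho^{n+1}_{i,j}}{M^n_{i,j}}\right)+\sum_{i=1}^{N_x}\sum_{j=1}^{N_y-1}h^x_iC^{n,*}_{i,j+1/2}\left(\log\frac{\rho^{n+1}_{i,j+1}}{M^n_{i,j+1}}-\log\frac{\rho^{n+1}_{i,j}}{M^n_{i,j}}\right)\ge0.$$
   Context: Mesh: $\Omega=[a,b]\times[c,d]$ is partitioned into cells $I_{i,j}=[x_{i-1/2},x_{i+1/2}]\times[y_{j-1/2},y_{j+1/2}]$, $1\le i\le N_x$, $1\le j\le N_y$, with $x_{1/2}=a$, $x_{N_x+1/2}=b$, $y_{1/2}=c$, $y_{N_y+1/2}=d$, side lengths $h^x_i,h^y_j>0$, area $|I_{i,j}|=h^x_ih^y_j$, and centers $(x_i,y_j)=(x_{i-1/2}+\frac12h^x_i,\,y_{j-1/2}+\frac12h^y_j)$. Set $h^x_{i+1/2}=(h^x_i+h^x_{i+1})/2$ and $h^y_{j+1/2}=(h^y_j+h^y_{j+1})/2$. For $x,y\in\mathbb{R}$ and $v\in\mathbb{R}^{N_x\times N_y}$ define $$Q_2(x,y,v)=\exp\Big(-V(x,y)-\sum_{k=1}^{N_x}\sum_{l=1}^{N_y}h^x_kh^y_lW(x_k-x,y_l-y)v_{k,l}\Big),$$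 and set $M^n_{i+1/2,j}=Q_2(x_{i+1/2},y_j,\rho^n)$, $M^n_{i,j+1/2}=Q_2(x_i,y_{j+1/2},\rho^n)$, $M^n_{i,j}=Q_2(x_i,y_j,\rho^n)$. The fluxes are $$C^{n,*}_{i+1/2,j}=\frac{M^n_{i+1/2,j}}{h^x_{i+1/2}}\Big(\frac{\rho^{n+1}_{i+1,j}}{M^n_{i+1,j}}-\frac{\rho^{n+1}_{i,j}}{M^n_{i,j}}\Big),\quad 1\le i\le N_x-1,\ 1\le j\le N_y,$$ $$C^{n,*}_{i,j+1/2}=\frac{M^n_{i,j+1/2}}{h^y_{j+1/2}}\Big(\frac{\rho^{n+1}_{i,j+1}}{M^n_{i,j+1}}-\frac{\rho^{n+1}_{i,j}}{M^n_{i,j}}\Big),\quad 1\le i\le N_x,\ 1\le j\le N_y-1,$$ and $C^{n,*}_{1/2,j}=C^{n,*}_{N_x+1/2,j}=C^{n,*}_{i,1/2}=C^{n,*}_{i,N_y+1/2}=0$ for all $i,j$. Each step is thus a linear system for $\rho^{n+1}$. The discrete free energy is $$E_h^n=\sum_{i=1}^{N_x}\sum_{j=1}^{N_y}h^x_ih^y_j\Big(\rho^n_{i,j}\log\rho^n_{i,j}+V(x_i,y_j)\rho^n_{i,j}+\tfrac12g^n_{i,j}\rho^n_{i,j}\Big),\qquad g^n_{i,j}=\sum_{k=1}^{N_x}\sum_{l=1}^{N_y}h^x_kh^y_lW(x_k-x_i,y_l-y_j)\rho^n_{k,l},$$ with the convention $0\log0=0$. In (3), $\rho^{n+1}$ is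 the result of one step with time step $\tau$ from the given $\rho^n$; $\tau^*$ may depend on $\rho^n$, the mesh, $V$ and $W$. *)

theory Defs
  imports "HOL-Analysis.Analysis"
begin

text \<open>
  Cells are numbered from 1 and the half-integer point \<open>x\<^sub>i\<^sub>+\<^sub>1\<^sub>/\<^sub>2\<close> is \<open>xface m i\<close>, so that
  \<open>x\<^sub>1\<^sub>/\<^sub>2 = xface m 0\<close> and cell \<open>i\<close> lies between \<open>xface m (i - 1)\<close> and \<open>xface m i\<close>.
  Quantities living on the interface \<open>i + 1/2\<close> are likewise indexed by \<open>i\<close>.
  Grid functions are total functions on \<open>nat \<times> nat\<close>; only their values at
  \<open>1 \<le> i \<le> nx m\<close>, \<open>1 \<le> j \<le> ny m\<close> are ever used.
\<close>

record mesh =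
  nx :: nat
  ny :: nat
  xface :: "nat \<Rightarrow> real"
  yface :: "nat \<Rightarrow> real"

type_synonym grid_fun = "nat \<Rightarrow> nat \<Rightarrow> real"

definition partition_of :: "real \<Rightarrow> real \<Rightarrow> nat \<Rightarrow> (nat \<Rightarrow> real) \<Rightarrow> bool" where
  "partition_of a b N p \<longleftrightarrow>
     N \<ge> 1 \<and> p 0 = a \<and> p N = b \<and> (\<forall>i\<in>{1..N}. p (i - 1) < p i)"

definition cartesian_mesh :: "mesh \<Rightarrow> real \<Rightarrow> real \<Rightarrow> real \<Rightarrow> real \<Rightarrow> bool" where
  "cartesian_mesh m a b c d \<longleftrightarrow>
     partition_of a b (nx m) (xface m) \<and> partition_of c d (ny m) (yface m)"

definition hx :: "mesh \<Rightarrow> nat \<Rightarrow> real" where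
  "hx m i = xface m i - xface m (i - 1)"

definition hy :: "mesh \<Rightarrow> nat \<Rightarrow> real" where
  "hy m j = yface m j - yface m (j - 1)"

definition xcenter :: "mesh \<Rightarrow> nat \<Rightarrow> real" where
  "xcenter m i = xface m (i - 1) + hx m i / 2"

definition ycenter :: "mesh \<Rightarrow> nat \<Rightarrow> real" where
  "ycenter m j = yface m (j - 1) + hy m j / 2"

definition hx_half :: "mesh \<Rightarrow> nat \<Rightarrow> real" where
  "hx_half m i = (hx m i + hx m (i + 1)) / 2"

definition hy_half :: "mesh \<Rightarrow> nat \<Rightarrow> real" where
  "hy_half m j = (hy m j + hy m (j + 1)) / 2"

definition cell :: "mesh \<Rightarrow> nat \<Rightarrow> nat \<Rightarrow> (real \<times> real) set" where
  "cell m i j = {xface m (i - 1)..xface m i} \<times> {yface m (j - 1)..yface m j}"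

definition Q2 :: "mesh \<Rightarrow> (real \<Rightarrow> real \<Rightarrow> real) \<Rightarrow> (real \<Rightarrow> real \<Rightarrow> real) \<Rightarrow>
    real \<Rightarrow> real \<Rightarrow> grid_fun \<Rightarrow> real" where
  "Q2 m V W x y v = exp (- V x y -
     (\<Sum>k=1..nx m. \<Sum>l=1..ny m. hx m k * hy m l * W (xcenter m k - x) (ycenter m l - y) * v k l))"

definition M_cell :: "mesh \<Rightarrow> (real \<Rightarrow> real \<Rightarrow> real) \<Rightarrow> (real \<Rightarrow> real \<Rightarrow> real) \<Rightarrow>
    grid_fun \<Rightarrow> nat \<Rightarrow> nat \<Rightarrow> real" where
  "M_cell m V W \<rho> i j = Q2 m V W (xcenter m i) (ycenter m j) \<rho>"

definition M_xface :: "mesh \<Rightarrow> (real \<Rightarrow> real \<Rightarrow> real) \<Rightarrow> (real \<Rightarrow> real \<Rightarrow> real) \<Rightarrow>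
    grid_fun \<Rightarrow> nat \<Rightarrow> nat \<Rightarrow> real" where
  "M_xface m V W \<rho> i j = Q2 m V W (xface m i) (ycenter m j) \<rho>"

definition M_yface :: "mesh \<Rightarrow> (real \<Rightarrow> real \<Rightarrow> real) \<Rightarrow> (real \<Rightarrow> real \<Rightarrow> real) \<Rightarrow>
    grid_fun \<Rightarrow> nat \<Rightarrow> nat \<Rightarrow> real" where
  "M_yface m V W \<rho> i j = Q2 m V W (xcenter m i) (yface m j) \<rho>"

text \<open>
  Below, \<open>\<rho>\<close> is the old density (entering the coefficients) and \<open>\<rho>'\<close> the new, unknown one.
\<close>

definition flux_x :: "mesh \<Rightarrow> (real \<Rightarrow> real \<Rightarrow> real) \<Rightarrow> (real \<Rightarrow> real \<Rightarrow> real) \<Rightarrow>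
    grid_fun \<Rightarrow> grid_fun \<Rightarrow> nat \<Rightarrow> nat \<Rightarrow> real" where
  "flux_x m V W \<rho> \<rho>' i j =
     (if 1 \<le> i \<and> i < nx m
      then M_xface m V W \<rho> i j / hx_half m i *
             (\<rho>' (i + 1) j / M_cell m V W \<rho> (i + 1) j - \<rho>' i j / M_cell m V W \<rho> i j)
      else 0)"

definition flux_y :: "mesh \<Rightarrow> (real \<Rightarrow> real \<Rightarrow> real) \<Rightarrow> (real \<Rightarrow> real \<Rightarrow> real) \<Rightarrow>
    grid_fun \<Rightarrow> grid_fun \<Rightarrow> nat \<Rightarrow> nat \<Rightarrow> real" where
  "flux_y m V W \<rho> \<rho>' i j =
     (if 1 \<le> j \<and> j < ny m
      then M_yface m V W \<rho> i j / hy_half m j *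
             (\<rho>' i (j + 1) / M_cell m V W \<rho> i (j + 1) - \<rho>' i j / M_cell m V W \<rho> i j)
      else 0)"

text \<open>
  The scheme is implicit, so one step is a relation: \<open>\<rho>'\<close> solves the linear system given by \<open>\<rho>\<close>.
\<close>

definition scheme_step :: "mesh \<Rightarrow> (real \<Rightarrow> real \<Rightarrow> real) \<Rightarrow> (real \<Rightarrow> real \<Rightarrow> real) \<Rightarrow>
    real \<Rightarrow> grid_fun \<Rightarrow> grid_fun \<Rightarrow> bool" where
  "scheme_step m V W \<tau> \<rho> \<rho>' \<longleftrightarrow>
     (\<forall>i\<in>{1..nx m}. \<forall>j\<in>{1..ny m}.
        (\<rho>' i j - \<rho> i j) / \<tau> =
          (flux_x m V W \<rho> \<rho>' i j - flux_x m V W \<rho> \<rho>' (i - 1) j) / hx m i +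
          (flux_y m V W \<rho> \<rho>' i j - flux_y m V W \<rho> \<rho>' i (j - 1)) / hy m j)"

definition interaction :: "mesh \<Rightarrow> (real \<Rightarrow> real \<Rightarrow> real) \<Rightarrow> grid_fun \<Rightarrow> nat \<Rightarrow> nat \<Rightarrow> real" where
  "interaction m W \<rho> i j =
     (\<Sum>k=1..nx m. \<Sum>l=1..ny m.
        hx m k * hy m l * W (xcenter m k - xcenter m i) (ycenter m l - ycenter m j) * \<rho> k l)"

text \<open>The convention \<open>0 log 0 = 0\<close> is automatic, as \<open>0 * ln 0 = 0\<close> in HOL.\<close>

definition free_energy :: "mesh \<Rightarrow> (real \<Rightarrow> real \<Rightarrow> real) \<Rightarrow> (real \<Rightarrow> real \<Rightarrow> real) \<Rightarrow>
    grid_fun \<Rightarrow> real" where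
  "free_energy m V W \<rho> =
     (\<Sum>i=1..nx m. \<Sum>j=1..ny m. hx m i * hy m j *
        (\<rho> i j * ln (\<rho> i j) + V (xcenter m i) (ycenter m j) * \<rho> i j
           + 1 / 2 * interaction m W \<rho> i j * \<rho> i j))"

definition dissipation :: "mesh \<Rightarrow> (real \<Rightarrow> real \<Rightarrow> real) \<Rightarrow> (real \<Rightarrow> real \<Rightarrow> real) \<Rightarrow>
    grid_fun \<Rightarrow> grid_fun \<Rightarrow> real" where
  "dissipation m V W \<rho> \<rho>' =
     (\<Sum>j=1..ny m. \<Sum>i=1..<nx m. hy m j * flux_x m V W \<rho> \<rho>' i j *
        (ln (\<rho>' (i + 1) j / M_cell m V W \<rho> (i + 1) j) - ln (\<rho>' i j / M_cell m V W \<rho> i j))) +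
     (\<Sum>i=1..nx m. \<Sum>j=1..<ny m. hx m i * flux_y m V W \<rho> \<rho>' i j *
        (ln (\<rho>' i (j + 1) / M_cell m V W \<rho> i (j + 1)) - ln (\<rho>' i j / M_cell m V W \<rho> i j)))"

end

theory Submission
  imports Defs
begin

text \<open>
  One step of the scheme is an implicit diffusion step on a weighted graph. The vertices are the
  cells, weighted by their areas; the edges are the interior faces, weighted by positive
  conductances \<open>k\<close>. With \<open>u = \<rho>' / M\<close>, summation by parts turns the scheme into the weak form
  \[ \textstyle\sum_p w_p (\rho'_p - \rho_p) \phi_p = - \tau D(u, \phi), \qquad
     D(f, g) = \sum_{(p, q)} k_{pq} (f_q - f_p)(g_q - g_p), \]
  valid for every grid function \<open>\<phi>\<close> (\<open>implicit_step_grid\<close>). Every claim comes from a choice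
  of \<open>\<phi>\<close>:

  \<^item> \<open>\<phi> = 1\<close> gives conservation of mass.
  \<^item> \<open>\<phi> = min u 0\<close> gives positivity: \<open>D(u, \<phi>) \<ge> 0\<close> by monotonicity, while the left-hand side is
    at least \<open>\<Sum>\<^sub>p w\<^sub>p M\<^sub>p \<phi>\<^sub>p\<^sup>2\<close>, so \<open>\<phi> = 0\<close>.
  \<^item> The indicator of \<open>{u = 0}\<close> gives strict positivity when \<open>\<rho> \<noteq> 0\<close>: no edge can join a zero of
    \<open>u\<close> to a nonzero value, so on a connected graph \<open>u\<close> vanishes nowhere or everywhere, and
    conservation of mass excludes the latter.
  \<^item> \<open>\<phi> = ln u\<close> produces the dissipation \<open>I = D(u, ln u)\<close>. As \<open>ln u = ln \<rho>' + V + g\<close>, with \<open>g\<close> the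
    interaction potential of \<open>\<rho>\<close>, convexity of \<open>x ln x\<close> and symmetry of \<open>W\<close> yield
    \<open>E(\<rho>') - E(\<rho>) \<le> - \<tau> I + R\<close>, where \<open>R\<close> is half the interaction form of \<open>\<rho>' - \<rho>\<close>
    (\<open>energy_step_le\<close>).
  \<^item> \<open>\<phi> = sgn (\<rho>' - \<rho>)\<close> bounds the weighted \<open>L\<^sup>1\<close> norm of \<open>\<rho>' - \<rho>\<close> by \<open>2 \<tau> S\<close>, where \<open>S\<close> is the
    sum of \<open>k\<^sub>p\<^sub>q \<bar>u\<^sub>q - u\<^sub>p\<bar>\<close> over the edges.

  The term \<open>R\<close> is therefore of order \<open>\<tau>\<^sup>2 S\<^sup>2\<close>. Mass conservation and positivity bound \<open>u\<close> by a
  constant \<open>B\<close> independent of \<open>\<tau>\<close>, hence \<open>(x - y) (ln x - ln y) \<ge> (x - y)\<^sup>2 / B\<close> for its values,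
  and Cauchy-Schwarz gives \<open>S\<^sup>2 \<le> (\<Sum> k) B I\<close> (\<open>total_flux_square_le\<close>). So \<open>R\<close> is at most a constant
  times \<open>\<tau>\<^sup>2 I\<close>, and half of \<open>\<tau> I\<close> absorbs it once \<open>\<tau>\<close> is small (\<open>energy_dissipation\<close>).
\<close>

section \<open>Elementary inequalities\<close>

text \<open>
  By the mean value theorem \<open>ln a - ln b\<close> is \<open>a - b\<close> divided by an intermediate point, which
  is at most \<open>B\<close>. The logarithmic dissipation therefore controls a quadratic one as long as the
  arguments stay bounded.
\<close>

lemma ln_diff_mult_ge:
  fixes a b B :: real
  assumes "0 < a" "0 < b" "a \<le> B" "b \<le> B"
  shows "(a - b)\<^sup>2 \<le> B * ((a - b) * (ln a - ln b))"
proof -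
  have key: "(x - y)\<^sup>2 \<le> B * ((x - y) * (ln x - ln y))"
    if "0 < y" "y \<le> x" "x \<le> B" for x y :: real
  proof -
    have "ln (y / x) \<le> y / x - 1"
      using that by (intro ln_le_minus_one) auto
    hence "x - y \<le> x * (ln x - ln y)"
      using that by (simp add: ln_div field_simps)
    also have "\<dots> \<le> B * (ln x - ln y)"
      using that by (intro mult_right_mono) auto
    finally have "(x - y) * (x - y) \<le> (x - y) * (B * (ln x - ln y))"
      using that by (intro mult_left_mono) auto
    thus ?thesis by (simp add: power2_eq_square mult_ac)
  qed
  show ?thesis
  proof (cases "b \<le> a")
    case True
    thus ?thesis using key[of b a] assms by simp
  next
    case False
    hence "(b - a)\<^sup>2 \<le> B * ((b - a) * (ln b - ln a))"
      using key[of a b] assms by simp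
    also have "(b - a) * (ln b - ln a) = (a - b) * (ln a - ln b)"
      by (simp add: algebra_simps)
    finally show ?thesis by (simp add: power2_commute)
  qed
qed

text \<open>
  The tangent of the convex function \<open>t ln t\<close> at \<open>y\<close> lies below it at \<open>x\<close>. At \<open>x = 0\<close>, where the
  function has no derivative, the convention \<open>0 ln 0 = 0\<close> keeps this true.
\<close>

lemma xlnx_tangent:
  fixes x y :: real
  assumes "0 \<le> x" "0 < y"
  shows "y * ln y - x * ln x \<le> (ln y + 1) * (y - x)"
proof (cases "x = 0")
  case True
  thus ?thesis using assms by (simp add: algebra_simps)
next
  case False
  with assms have "ln (y / x) \<le> y / x - 1"
    by (intro ln_le_minus_one) auto
  hence "x * (ln y - ln x) \<le> x * (y / x - 1)"
    using False assms by (intro mult_left_mono) (auto simp: ln_div)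
  thus ?thesis using False by (simp add: algebra_simps)
qed

section \<open>Implicit diffusion steps on a weighted graph\<close>

text \<open>
  Each edge is stored with one orientation only; the Dirichlet form below does not depend on
  which. Connectedness is expressed by predicates, in the form in which it is applied: a set of
  vertices that no edge leaves or enters is empty or everything.
\<close>

locale weighted_graph =
  fixes P :: "'v set" and E :: "('v \<times> 'v) set"
    and w :: "'v \<Rightarrow> real" and k :: "'v \<times> 'v \<Rightarrow> real"
  assumes finite_vertices: "finite P"
    and edges: "E \<subseteq> P \<times> P"
    and weight_pos: "p \<in> P \<Longrightarrow> 0 < w p"
    and conductance_pos: "e \<in> E \<Longrightarrow> 0 < k e"
    and connected: "\<lbrakk>\<And>p q. (p, q) \<in> E \<Longrightarrow> f p = f q; p \<in> P; q \<in> P\<rbrakk> \<Longrightarrow> (f p :: bool) = f q"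
begin

definition mass :: "('v \<Rightarrow> real) \<Rightarrow> real" where
  "mass f = (\<Sum>p\<in>P. w p * f p)"

definition dirichlet :: "('v \<Rightarrow> real) \<Rightarrow> ('v \<Rightarrow> real) \<Rightarrow> real" where
  "dirichlet f g = (\<Sum>(p, q)\<in>E. k (p, q) * ((f q - f p) * (g q - g p)))"

text \<open>
  The weak form of \<open>(\<rho>' - \<rho>) / \<tau> = L (\<rho>' / M)\<close>, where \<open>L\<close> is the weighted graph Laplacian.
\<close>

definition implicit_step :: "('v \<Rightarrow> real) \<Rightarrow> real \<Rightarrow> ('v \<Rightarrow> real) \<Rightarrow> ('v \<Rightarrow> real) \<Rightarrow> bool" where
  "implicit_step M \<tau> \<rho> \<rho>' \<longleftrightarrow>
     (\<forall>\<phi>. (\<Sum>p\<in>P. w p * (\<rho>' p - \<rho> p) * \<phi> p) = - \<tau> * dirichlet (\<lambda>p. \<rho>' p / M p) \<phi>)"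

lemma finite_edges: "finite E"
  using edges finite_vertices by (meson finite_SigmaI finite_subset)

lemma implicit_stepD:
  "implicit_step M \<tau> \<rho> \<rho>' \<Longrightarrow>
     (\<Sum>p\<in>P. w p * (\<rho>' p - \<rho> p) * \<phi> p) = - \<tau> * dirichlet (\<lambda>p. \<rho>' p / M p) \<phi>"
  unfolding implicit_step_def by blast

lemma mass_conserved:
  assumes "implicit_step M \<tau> \<rho> \<rho>'"
  shows "mass \<rho>' = mass \<rho>"
  using implicit_stepD[OF assms, of "\<lambda>_. 1"]
  by (simp add: dirichlet_def mass_def right_diff_distrib sum_subtractf)

text \<open>
  Testing with the negative part of \<open>\<rho>' / M\<close>: truncation is monotone, so the Dirichlet form is
  nonnegative and the left-hand side is at most 0. But it is also at least the sum of
  \<open>w M \<phi>\<^sup>2\<close>, because \<open>\<rho>' \<phi> = M \<phi>\<^sup>2\<close> and \<open>\<rho> \<phi> \<le> 0\<close>.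
\<close>

lemma implicit_step_nonneg:
  assumes M: "\<And>p. p \<in> P \<Longrightarrow> 0 < M p" and "0 < \<tau>"
    and step: "implicit_step M \<tau> \<rho> \<rho>'"
    and \<rho>: "\<And>p. p \<in> P \<Longrightarrow> 0 \<le> \<rho> p"
    and "p \<in> P"
  shows "0 \<le> \<rho>' p"
proof -
  define u where "u = (\<lambda>p. \<rho>' p / M p)"
  define \<phi> where "\<phi> p = min (u p) 0" for p
  have "0 \<le> dirichlet u \<phi>"
    unfolding dirichlet_def
  proof (rule sum_nonneg, clarify)
    fix p q assume "(p, q) \<in> E"
    have "0 \<le> (u q - u p) * (\<phi> q - \<phi> p)"
      by (auto simp: \<phi>_def min_def zero_le_mult_iff)
    thus "0 \<le> k (p, q) * ((u q - u p) * (\<phi> q - \<phi> p))"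
      using conductance_pos[OF \<open>(p, q) \<in> E\<close>] by simp
  qed
  hence le: "(\<Sum>p\<in>P. w p * (\<rho>' p - \<rho> p) * \<phi> p) \<le> 0"
    using implicit_stepD[OF step, of \<phi>] \<open>0 < \<tau>\<close> by (simp add: u_def)
  have term_ge: "w p * M p * (\<phi> p)\<^sup>2 \<le> w p * (\<rho>' p - \<rho> p) * \<phi> p" if "p \<in> P" for p
  proof -
    have "\<rho>' p * \<phi> p = M p * (\<phi> p)\<^sup>2"
      using M[OF that] by (auto simp: \<phi>_def u_def min_def power2_eq_square)
    moreover have "\<rho> p * \<phi> p \<le> 0"
      using \<rho>[OF that] by (simp add: \<phi>_def mult_nonneg_nonpos)
    ultimately have "M p * (\<phi> p)\<^sup>2 \<le> (\<rho>' p - \<rho> p) * \<phi> p"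
      by (simp add: left_diff_distrib)
    thus ?thesis
      using weight_pos[OF that] by (simp add: mult.assoc)
  qed
  have nonneg: "0 \<le> w p * M p * (\<phi> p)\<^sup>2" if "p \<in> P" for p
    using weight_pos[OF that] M[OF that] by simp
  have "(\<Sum>p\<in>P. w p * M p * (\<phi> p)\<^sup>2) \<le> 0"
    using sum_mono[OF term_ge] le by (rule order_trans)
  hence "(\<Sum>p\<in>P. w p * M p * (\<phi> p)\<^sup>2) = 0"
    using sum_nonneg[OF nonneg] by (rule antisym)
  hence "w p * M p * (\<phi> p)\<^sup>2 = 0"
    using sum_nonneg_eq_0_iff[OF finite_vertices, of "\<lambda>p. w p * M p * (\<phi> p)\<^sup>2"] nonneg
      \<open>p \<in> P\<close> by blast
  hence "\<phi> p = 0"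
    using weight_pos[OF \<open>p \<in> P\<close>] M[OF \<open>p \<in> P\<close>] by simp
  hence "0 \<le> u p" by (simp add: \<phi>_def min_def split: if_splits)
  thus ?thesis
    using M[OF \<open>p \<in> P\<close>] by (simp add: u_def zero_le_divide_iff)
qed

text \<open>
  A strong maximum principle. Testing with the indicator of \<open>{u = 0}\<close>, the left-hand side is
  nonpositive because \<open>\<rho>'\<close> vanishes there, and every edge contributes a nonnegative amount to the
  right-hand side. So all contributions vanish and the zero set is a union of components.
\<close>

lemma implicit_step_pos:
  assumes M: "\<And>p. p \<in> P \<Longrightarrow> 0 < M p" and "0 < \<tau>"
    and step: "implicit_step M \<tau> \<rho> \<rho>'"
    and \<rho>: "\<And>p. p \<in> P \<Longrightarrow> 0 \<le> \<rho> p" and ne: "\<exists>p\<in>P. \<rho> p \<noteq> 0"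
    and "p \<in> P"
  shows "0 < \<rho>' p"
proof -
  define u where "u = (\<lambda>p. \<rho>' p / M p)"
  define \<phi> where "\<phi> p = (if u p = 0 then 1 else 0 :: real)" for p
  have \<rho>'_nonneg: "0 \<le> \<rho>' p" if "p \<in> P" for p
    by (rule implicit_step_nonneg[OF M \<open>0 < \<tau>\<close> step \<rho> that])
  have u_nonneg: "0 \<le> u p" if "p \<in> P" for p
    using M[OF that] \<rho>'_nonneg[OF that] by (simp add: u_def)
  have u_zero: "u p = 0 \<longleftrightarrow> \<rho>' p = 0" if "p \<in> P" for p
    using M[OF that] by (simp add: u_def)
  have nonneg: "0 \<le> - (k (p, q) * ((u q - u p) * (\<phi> q - \<phi> p)))" if "(p, q) \<in> E" for p q
  proof -
    have "p \<in> P" "q \<in> P" using that edges by auto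
    hence "(u q - u p) * (\<phi> q - \<phi> p) \<le> 0"
      using u_nonneg[of p] u_nonneg[of q] by (auto simp: \<phi>_def)
    thus ?thesis
      using conductance_pos[OF that] by (simp add: mult_nonneg_nonpos)
  qed
  have "(\<Sum>p\<in>P. w p * (\<rho>' p - \<rho> p) * \<phi> p) \<le> 0"
  proof (rule sum_nonpos)
    fix p assume "p \<in> P"
    thus "w p * (\<rho>' p - \<rho> p) * \<phi> p \<le> 0"
      using \<rho>[of p] weight_pos[of p] u_zero[of p] by (auto simp: \<phi>_def mult_nonneg_nonpos)
  qed
  hence "- \<tau> * dirichlet u \<phi> \<le> 0"
    using implicit_stepD[OF step, of \<phi>] by (simp add: u_def)
  hence "- dirichlet u \<phi> \<le> 0"
    using \<open>0 < \<tau>\<close> by (simp add: zero_le_mult_iff)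
  hence "(\<Sum>e\<in>E. - (case e of (p, q) \<Rightarrow> k (p, q) * ((u q - u p) * (\<phi> q - \<phi> p)))) \<le> 0"
    by (simp add: dirichlet_def sum_negf)
  hence "(\<Sum>e\<in>E. - (case e of (p, q) \<Rightarrow> k (p, q) * ((u q - u p) * (\<phi> q - \<phi> p)))) = 0"
    by (intro antisym sum_nonneg) (use nonneg in \<open>auto split: prod.splits\<close>)
  hence all0: "\<forall>e\<in>E. - (case e of (p, q) \<Rightarrow> k (p, q) * ((u q - u p) * (\<phi> q - \<phi> p))) = 0"
    by (subst (asm) sum_nonneg_eq_0_iff[OF finite_edges])
       (use nonneg in \<open>auto split: prod.splits\<close>)
  have same: "(u p = 0) = (u q = 0)" if "(p, q) \<in> E" for p q
  proof -
    have "(u q - u p) * (\<phi> q - \<phi> p) = 0"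
      using all0 that conductance_pos[OF that] by fastforce
    thus ?thesis by (auto simp: \<phi>_def split: if_splits)
  qed
  have "\<rho>' p \<noteq> 0"
  proof
    assume "\<rho>' p = 0"
    hence "u p = 0" using u_zero \<open>p \<in> P\<close> by simp
    have "u q = 0" if "q \<in> P" for q
      using connected[of "\<lambda>p. u p = 0" p q] same \<open>p \<in> P\<close> that \<open>u p = 0\<close> by blast
    hence "\<rho>' q = 0" if "q \<in> P" for q using u_zero that by blast
    hence "mass \<rho>' = 0" by (simp add: mass_def)
    hence "mass \<rho> = 0" using mass_conserved[OF step] by simp
    hence "\<forall>p\<in>P. w p * \<rho> p = 0"
      unfolding mass_def
      by (subst (asm) sum_nonneg_eq_0_iff[OF finite_vertices])
         (use \<rho> weight_pos in \<open>auto simp: less_imp_le\<close>)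
    thus False using ne weight_pos by fastforce
  qed
  thus ?thesis using \<rho>'_nonneg[OF \<open>p \<in> P\<close>] by simp
qed

text \<open>
  No cell can hold more than the total mass. The bound depends on \<open>\<rho>\<close> but not on \<open>\<tau>\<close>, which is
  what allows a threshold for \<open>\<tau>\<close> to be fixed in advance.
\<close>

lemma implicit_step_le_mass:
  assumes M: "\<And>p. p \<in> P \<Longrightarrow> 0 < M p" and "0 < \<tau>"
    and step: "implicit_step M \<tau> \<rho> \<rho>'"
    and \<rho>: "\<And>p. p \<in> P \<Longrightarrow> 0 \<le> \<rho> p"
    and "p \<in> P"
  shows "\<rho>' p / M p \<le> mass \<rho> / (w p * M p)"
proof -
  have \<rho>'_nonneg: "0 \<le> \<rho>' p" if "p \<in> P" for p
    by (rule implicit_step_nonneg[OF M \<open>0 < \<tau>\<close> step \<rho> that])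
  have "w p * \<rho>' p \<le> mass \<rho>'"
    unfolding mass_def
    by (rule member_le_sum[OF \<open>p \<in> P\<close> _ finite_vertices])
       (use \<rho>'_nonneg weight_pos in \<open>auto simp: less_imp_le\<close>)
  hence "w p * \<rho>' p / (w p * M p) \<le> mass \<rho> / (w p * M p)"
    using mass_conserved[OF step] M[OF \<open>p \<in> P\<close>] weight_pos[OF \<open>p \<in> P\<close>]
    by (intro divide_right_mono) auto
  thus ?thesis using weight_pos[OF \<open>p \<in> P\<close>] by simp
qed

text \<open>
  Testing with the sign of the increment, whose jump across an edge is at most 2. The increment
  is thus of order \<open>\<tau>\<close> times the total flux.
\<close>

lemma implicit_step_l1_le:
  assumes "0 < \<tau>" and step: "implicit_step M \<tau> \<rho> \<rho>'"
  shows "(\<Sum>p\<in>P. w p * \<bar>\<rho>' p - \<rho> p\<bar>) \<le>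
           2 * \<tau> * (\<Sum>(p, q)\<in>E. k (p, q) * \<bar>\<rho>' q / M q - \<rho>' p / M p\<bar>)"
proof -
  define u where "u = (\<lambda>p. \<rho>' p / M p)"
  define \<phi> where "\<phi> p = sgn (\<rho>' p - \<rho> p)" for p
  have "(\<Sum>p\<in>P. w p * \<bar>\<rho>' p - \<rho> p\<bar>) = (\<Sum>p\<in>P. w p * (\<rho>' p - \<rho> p) * \<phi> p)"
    by (simp add: \<phi>_def abs_sgn mult.assoc)
  also have "\<dots> = \<tau> * - dirichlet u \<phi>"
    using implicit_stepD[OF step] by (simp add: u_def)
  also have "- dirichlet u \<phi> \<le> (\<Sum>(p, q)\<in>E. 2 * (k (p, q) * \<bar>u q - u p\<bar>))"
    unfolding dirichlet_def sum_negf[symmetric]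
  proof (rule sum_mono, clarify)
    fix p q assume "(p, q) \<in> E"
    have "- ((u q - u p) * (\<phi> q - \<phi> p)) \<le> \<bar>(u q - u p) * (\<phi> q - \<phi> p)\<bar>"
      by linarith
    also have "\<dots> \<le> \<bar>u q - u p\<bar> * 2"
      unfolding abs_mult by (intro mult_left_mono) (auto simp: \<phi>_def sgn_if)
    finally have "k (p, q) * - ((u q - u p) * (\<phi> q - \<phi> p)) \<le> k (p, q) * (\<bar>u q - u p\<bar> * 2)"
      using conductance_pos[OF \<open>(p, q) \<in> E\<close>] by (intro mult_left_mono) auto
    thus "- (k (p, q) * ((u q - u p) * (\<phi> q - \<phi> p))) \<le> 2 * (k (p, q) * \<bar>u q - u p\<bar>)"
      by (simp add: mult_ac)
  qed
  also have "\<dots> = 2 * (\<Sum>(p, q)\<in>E. k (p, q) * \<bar>u q - u p\<bar>)"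
    by (simp add: sum_distrib_left case_prod_unfold)
  finally show ?thesis
    using \<open>0 < \<tau>\<close> by (simp add: u_def mult_ac)
qed

lemma dirichlet_ln_nonneg:
  assumes "\<And>p. p \<in> P \<Longrightarrow> 0 < u p"
  shows "0 \<le> dirichlet u (\<lambda>p. ln (u p))"
  unfolding dirichlet_def
proof (rule sum_nonneg, clarify)
  fix p q assume e: "(p, q) \<in> E"
  hence "0 < u p" "0 < u q" using assms edges by auto
  hence "0 \<le> (u q - u p) * (ln (u q) - ln (u p))"
    by (cases "u p \<le> u q") (auto simp: zero_le_mult_iff)
  thus "0 \<le> k (p, q) * ((u q - u p) * (ln (u q) - ln (u p)))"
    using conductance_pos[OF e] by simp
qed

text \<open>
  Cauchy-Schwarz with the splitting \<open>k = sqrt k * sqrt k\<close>, and then the comparison of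
  \<open>(u\<^sub>q - u\<^sub>p)\<^sup>2\<close> with \<open>(u\<^sub>q - u\<^sub>p) (ln u\<^sub>q - ln u\<^sub>p)\<close> on each edge.
\<close>

lemma total_flux_square_le:
  assumes u: "\<And>p. p \<in> P \<Longrightarrow> 0 < u p" "\<And>p. p \<in> P \<Longrightarrow> u p \<le> B"
  shows "(\<Sum>(p, q)\<in>E. k (p, q) * \<bar>u q - u p\<bar>)\<^sup>2 \<le> sum k E * (B * dirichlet u (\<lambda>p. ln (u p)))"
proof -
  define D where "D e = \<bar>u (snd e) - u (fst e)\<bar>" for e
  have k: "0 \<le> k e" if "e \<in> E" for e using conductance_pos[OF that] by simp
  have "(\<Sum>(p, q)\<in>E. k (p, q) * \<bar>u q - u p\<bar>) = (\<Sum>e\<in>E. sqrt (k e) * (sqrt (k e) * D e))"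
    by (intro sum.cong) (use k in \<open>auto simp: D_def mult.assoc[symmetric]\<close>)
  hence "(\<Sum>(p, q)\<in>E. k (p, q) * \<bar>u q - u p\<bar>)\<^sup>2 \<le>
           (\<Sum>e\<in>E. (sqrt (k e))\<^sup>2) * (\<Sum>e\<in>E. (sqrt (k e) * D e)\<^sup>2)"
    by (simp only: Cauchy_Schwarz_ineq_sum)
  also have "(\<Sum>e\<in>E. (sqrt (k e))\<^sup>2) = sum k E"
    by (intro sum.cong) (use k in auto)
  also have "(\<Sum>e\<in>E. (sqrt (k e) * D e)\<^sup>2) \<le> B * dirichlet u (\<lambda>p. ln (u p))"
    unfolding dirichlet_def sum_distrib_left
  proof (rule sum_mono, clarify)
    fix p q assume e: "(p, q) \<in> E"
    hence "p \<in> P" "q \<in> P" using edges by auto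
    hence "(u q - u p)\<^sup>2 \<le> B * ((u q - u p) * (ln (u q) - ln (u p)))"
      using u by (intro ln_diff_mult_ge) auto
    hence "k (p, q) * (u q - u p)\<^sup>2 \<le> k (p, q) * (B * ((u q - u p) * (ln (u q) - ln (u p))))"
      using k[OF e] by (rule mult_left_mono)
    thus "(sqrt (k (p, q)) * D (p, q))\<^sup>2 \<le>
            B * (k (p, q) * ((u q - u p) * (ln (u q) - ln (u p))))"
      using k[OF e] by (simp add: D_def power_mult_distrib mult_ac)
  qed
  hence "sum k E * (\<Sum>e\<in>E. (sqrt (k e) * D e)\<^sup>2) \<le> sum k E * (B * dirichlet u (\<lambda>p. ln (u p)))"
    using sum_nonneg[OF k] by (intro mult_left_mono) auto
  finally show ?thesis .
qed

section \<open>Free energy on a weighted graph\<close>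

definition potential :: "('v \<Rightarrow> 'v \<Rightarrow> real) \<Rightarrow> ('v \<Rightarrow> real) \<Rightarrow> 'v \<Rightarrow> real" where
  "potential W f p = (\<Sum>q\<in>P. w q * W q p * f q)"

definition energy :: "('v \<Rightarrow> real) \<Rightarrow> ('v \<Rightarrow> 'v \<Rightarrow> real) \<Rightarrow> ('v \<Rightarrow> real) \<Rightarrow> real" where
  "energy V W f = (\<Sum>p\<in>P. w p * (f p * ln (f p) + V p * f p + 1 / 2 * potential W f p * f p))"

text \<open>
  The chemical potential of the step is \<open>ln (\<rho>' / M) = ln \<rho>' + V + g\<close>, where \<open>g\<close> is the
  potential generated by the old density. The entropy is convex, so evaluating its derivative at
  \<open>\<rho>'\<close> only helps; its constant 1 disappears by conservation of mass. The interaction energy is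
  quadratic, and freezing \<open>g\<close> at \<open>\<rho>\<close> costs exactly the quadratic form of the increment.
\<close>

lemma energy_step_le:
  assumes M: "\<And>p. p \<in> P \<Longrightarrow> M p = exp (- V p - potential W \<rho> p)"
    and W: "\<And>p q. \<lbrakk>p \<in> P; q \<in> P\<rbrakk> \<Longrightarrow> W p q = W q p"
    and step: "implicit_step M \<tau> \<rho> \<rho>'"
    and \<rho>: "\<And>p. p \<in> P \<Longrightarrow> 0 \<le> \<rho> p" and \<rho>': "\<And>p. p \<in> P \<Longrightarrow> 0 < \<rho>' p"
  shows "energy V W \<rho>' - energy V W \<rho> \<le>
           - \<tau> * dirichlet (\<lambda>p. \<rho>' p / M p) (\<lambda>p. ln (\<rho>' p / M p)) +
           1 / 2 * (\<Sum>p\<in>P. w p * potential W (\<lambda>q. \<rho>' q - \<rho> q) p * (\<rho>' p - \<rho> p))"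
proof -
  define \<delta> where "\<delta> = (\<lambda>p. \<rho>' p - \<rho> p)"
  define B where "B f g = (\<Sum>p\<in>P. w p * potential W f p * g p)" for f g
  have B_sym: "B f g = B g f" for f g
  proof -
    have "B f g = (\<Sum>p\<in>P. \<Sum>q\<in>P. w p * (w q * W q p * f q) * g p)"
      by (simp add: B_def potential_def sum_distrib_left sum_distrib_right)
    also have "\<dots> = (\<Sum>q\<in>P. \<Sum>p\<in>P. w p * (w q * W q p * f q) * g p)"
      by (rule sum.swap)
    also have "\<dots> = (\<Sum>q\<in>P. \<Sum>p\<in>P. w q * (w p * W p q * g p) * f q)"
      by (intro sum.cong refl) (simp add: W mult_ac)
    also have "\<dots> = B g f"
      by (simp add: B_def potential_def sum_distrib_left sum_distrib_right)
    finally show ?thesis .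
  qed
  have B_add: "B f (\<lambda>p. g p + h p) = B f g + B f h" for f g h
    by (simp add: B_def distrib_left sum.distrib)
  have "B \<rho>' \<rho>' = B (\<lambda>p. \<rho> p + \<delta> p) (\<lambda>p. \<rho> p + \<delta> p)"
    by (simp add: \<delta>_def)
  also have "\<dots> = B \<rho> \<rho> + 2 * B \<rho> \<delta> + B \<delta> \<delta>"
    unfolding B_add by (simp add: B_sym[of "\<lambda>p. \<rho> p + \<delta> p"] B_add B_sym[of \<delta> \<rho>])
  finally have quad: "1 / 2 * B \<rho>' \<rho>' - 1 / 2 * B \<rho> \<rho> = B \<rho> \<delta> + 1 / 2 * B \<delta> \<delta>"
    by linarith
  have en: "energy V W f = (\<Sum>p\<in>P. w p * (f p * ln (f p))) + (\<Sum>p\<in>P. w p * (V p * f p))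
              + 1 / 2 * B f f" for f
    by (simp add: energy_def B_def distrib_left sum.distrib sum_distrib_left mult_ac)
  have ent: "(\<Sum>p\<in>P. w p * (\<rho>' p * ln (\<rho>' p))) - (\<Sum>p\<in>P. w p * (\<rho> p * ln (\<rho> p)))
               \<le> (\<Sum>p\<in>P. w p * ((ln (\<rho>' p) + 1) * \<delta> p))"
    unfolding sum_subtractf[symmetric] right_diff_distrib[symmetric]
    by (intro sum_mono mult_left_mono)
       (use xlnx_tangent[OF \<rho> \<rho>'] weight_pos in \<open>auto simp: \<delta>_def less_imp_le\<close>)
  have "(\<Sum>p\<in>P. w p * \<delta> p) = 0"
    using mass_conserved[OF step]
    by (simp add: mass_def \<delta>_def right_diff_distrib sum_subtractf)
  hence drop1: "(\<Sum>p\<in>P. w p * ((ln (\<rho>' p) + 1) * \<delta> p)) = (\<Sum>p\<in>P. w p * (ln (\<rho>' p) * \<delta> p))"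
    by (simp add: distrib_left distrib_right sum.distrib)
  have lin: "(\<Sum>p\<in>P. w p * (V p * \<rho>' p)) - (\<Sum>p\<in>P. w p * (V p * \<rho> p)) =
               (\<Sum>p\<in>P. w p * (V p * \<delta> p))"
    by (simp add: \<delta>_def sum_subtractf right_diff_distrib)
  have "(\<Sum>p\<in>P. w p * (ln (\<rho>' p) * \<delta> p)) + (\<Sum>p\<in>P. w p * (V p * \<delta> p)) + B \<rho> \<delta> =
          (\<Sum>p\<in>P. w p * \<delta> p * ln (\<rho>' p / M p))"
    unfolding B_def sum.distrib[symmetric]
  proof (rule sum.cong[OF refl])
    fix p assume p: "p \<in> P"
    have "ln (\<rho>' p / M p) = ln (\<rho>' p) + V p + potential W \<rho> p"
      using \<rho>'[OF p] by (simp add: M[OF p] ln_div)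
    thus "w p * (ln (\<rho>' p) * \<delta> p) + w p * (V p * \<delta> p) + w p * potential W \<rho> p * \<delta> p =
            w p * \<delta> p * ln (\<rho>' p / M p)"
      by (simp add: algebra_simps)
  qed
  also have "\<dots> = - \<tau> * dirichlet (\<lambda>p. \<rho>' p / M p) (\<lambda>p. ln (\<rho>' p / M p))"
    unfolding \<delta>_def by (rule implicit_stepD[OF step])
  finally have chem: "(\<Sum>p\<in>P. w p * (ln (\<rho>' p) * \<delta> p)) + (\<Sum>p\<in>P. w p * (V p * \<delta> p)) + B \<rho> \<delta> =
      - \<tau> * dirichlet (\<lambda>p. \<rho>' p / M p) (\<lambda>p. ln (\<rho>' p / M p))" .
  have "B \<delta> \<delta> = (\<Sum>p\<in>P. w p * potential W (\<lambda>q. \<rho>' q - \<rho> q) p * (\<rho>' p - \<rho> p))"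
    by (simp add: B_def \<delta>_def)
  thus ?thesis
    using ent drop1 lin quad chem en[of \<rho>] en[of \<rho>'] by linarith
qed

lemma interaction_le_l1:
  assumes W: "\<And>p q. \<lbrakk>p \<in> P; q \<in> P\<rbrakk> \<Longrightarrow> \<bar>W p q\<bar> \<le> K"
  shows "(\<Sum>p\<in>P. w p * potential W f p * f p) \<le> K * (\<Sum>p\<in>P. w p * \<bar>f p\<bar>)\<^sup>2"
proof -
  have "(\<Sum>p\<in>P. w p * potential W f p * f p) =
          (\<Sum>p\<in>P. \<Sum>q\<in>P. w p * (w q * W q p * f q) * f p)"
    by (simp add: potential_def sum_distrib_left sum_distrib_right)
  also have "\<dots> \<le> (\<Sum>p\<in>P. \<Sum>q\<in>P. K * ((w p * \<bar>f p\<bar>) * (w q * \<bar>f q\<bar>)))"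
  proof (intro sum_mono)
    fix p q assume "p \<in> P" "q \<in> P"
    have "w p * (w q * W q p * f q) * f p \<le> \<bar>w p * (w q * W q p * f q) * f p\<bar>"
      by (rule abs_ge_self)
    also have "\<dots> = \<bar>W q p\<bar> * ((w p * \<bar>f p\<bar>) * (w q * \<bar>f q\<bar>))"
      using weight_pos[OF \<open>p \<in> P\<close>] weight_pos[OF \<open>q \<in> P\<close>] by (simp add: abs_mult)
    also have "\<dots> \<le> K * ((w p * \<bar>f p\<bar>) * (w q * \<bar>f q\<bar>))"
      using weight_pos[OF \<open>p \<in> P\<close>] weight_pos[OF \<open>q \<in> P\<close>] W[OF \<open>q \<in> P\<close> \<open>p \<in> P\<close>]
      by (intro mult_right_mono) auto
    finally show "w p * (w q * W q p * f q) * f p \<le> K * ((w p * \<bar>f p\<bar>) * (w q * \<bar>f q\<bar>))" .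
  qed
  also have "\<dots> = K * (\<Sum>p\<in>P. w p * \<bar>f p\<bar>)\<^sup>2"
    unfolding power2_eq_square sum_product by (simp only: sum_distrib_left)
  finally show ?thesis .
qed

text \<open>
  The threshold is chosen so that the interaction of the increment with itself, which is at most
  \<open>4 L \<tau> * \<tau> I\<close>, does not exceed \<open>\<tau> I\<close>. The constant \<open>L\<close> collects the size of the kernel,
  the total conductance and the a priori bound \<open>B\<close> on \<open>\<rho>' / M\<close>.
\<close>

lemma energy_dissipation:
  assumes M: "\<And>p. p \<in> P \<Longrightarrow> M p = exp (- V p - potential W \<rho> p)"
    and W: "\<And>p q. \<lbrakk>p \<in> P; q \<in> P\<rbrakk> \<Longrightarrow> W p q = W q p"
    and \<rho>: "\<And>p. p \<in> P \<Longrightarrow> 0 \<le> \<rho> p" and ne: "\<exists>p\<in>P. \<rho> p \<noteq> 0"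
  obtains \<tau>\<^sub>s where "0 < \<tau>\<^sub>s"
    and "\<And>\<tau> \<rho>'. \<lbrakk>0 < \<tau>; \<tau> < \<tau>\<^sub>s; implicit_step M \<tau> \<rho> \<rho>'\<rbrakk> \<Longrightarrow>
           energy V W \<rho>' - energy V W \<rho> \<le>
             - (\<tau> / 2) * dirichlet (\<lambda>p. \<rho>' p / M p) (\<lambda>p. ln (\<rho>' p / M p)) \<and>
           0 \<le> dirichlet (\<lambda>p. \<rho>' p / M p) (\<lambda>p. ln (\<rho>' p / M p))"
proof -
  have M_pos: "0 < M p" if "p \<in> P" for p using M[OF that] by simp
  define B where "B = (\<Sum>p\<in>P. mass \<rho> / (w p * M p))"
  define K where "K = (\<Sum>p\<in>P. \<Sum>q\<in>P. \<bar>W p q\<bar>)"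
  define L where "L = K * (sum k E * B)"
  have mass_nonneg: "0 \<le> mass \<rho>"
    unfolding mass_def using \<rho> weight_pos by (intro sum_nonneg) (simp add: less_imp_le)
  have summand_nonneg: "0 \<le> mass \<rho> / (w p * M p)" if "p \<in> P" for p
    using mass_nonneg weight_pos[OF that] M_pos[OF that] by simp
  have le_B: "mass \<rho> / (w p * M p) \<le> B" if "p \<in> P" for p
    unfolding B_def using that summand_nonneg finite_vertices by (intro member_le_sum) auto
  have B_nonneg: "0 \<le> B"
    unfolding B_def by (rule sum_nonneg[OF summand_nonneg])
  have K_nonneg: "0 \<le> K" unfolding K_def by (intro sum_nonneg) auto
  have W_le: "\<bar>W p q\<bar> \<le> K" if "p \<in> P" "q \<in> P" for p q
  proof -
    have "\<bar>W p q\<bar> \<le> (\<Sum>q\<in>P. \<bar>W p q\<bar>)"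
      using that finite_vertices by (intro member_le_sum) auto
    also have "\<dots> \<le> K"
      unfolding K_def
      by (rule member_le_sum[OF that(1)]) (auto intro: finite_vertices sum_nonneg)
    finally show ?thesis .
  qed
  have "0 \<le> sum k E" by (intro sum_nonneg) (simp add: conductance_pos less_imp_le)
  hence L_nonneg: "0 \<le> L" unfolding L_def using K_nonneg B_nonneg by simp
  show thesis
  \<comment> \<open>Any positive bound below \<open>1 / (4 * L)\<close> works; adding 1 keeps the quotient positive when
     \<open>L = 0\<close>.\<close>
  proof (rule that[of "1 / (4 * L + 1)"])
    show "0 < 1 / (4 * L + 1)" using L_nonneg by simp
  next
    fix \<tau> \<rho>'
    assume "0 < \<tau>" "\<tau> < 1 / (4 * L + 1)" and step: "implicit_step M \<tau> \<rho> \<rho>'"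
    hence "\<tau> * (4 * L + 1) < 1" using L_nonneg by (simp add: field_simps)
    hence small: "4 * L * \<tau> \<le> 1" using \<open>0 < \<tau>\<close> by (simp add: algebra_simps)
    define u where "u = (\<lambda>p. \<rho>' p / M p)"
    define I where "I = dirichlet u (\<lambda>p. ln (u p))"
    define S where "S = (\<Sum>(p, q)\<in>E. k (p, q) * \<bar>u q - u p\<bar>)"
    define N where "N = (\<Sum>p\<in>P. w p * \<bar>\<rho>' p - \<rho> p\<bar>)"
    have \<rho>'_pos: "0 < \<rho>' p" if "p \<in> P" for p
      by (rule implicit_step_pos[OF M_pos \<open>0 < \<tau>\<close> step \<rho> ne that])
    have u_pos: "0 < u p" if "p \<in> P" for p
      using \<rho>'_pos[OF that] M_pos[OF that] by (simp add: u_def)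
    have u_le: "u p \<le> B" if "p \<in> P" for p
      using implicit_step_le_mass[OF M_pos \<open>0 < \<tau>\<close> step \<rho> that] le_B[OF that]
      by (simp add: u_def)
    have I_nonneg: "0 \<le> I"
      unfolding I_def by (rule dirichlet_ln_nonneg[OF u_pos])
    have "0 \<le> N"
      unfolding N_def using weight_pos by (intro sum_nonneg) (simp add: less_imp_le)
    moreover have "N \<le> 2 * \<tau> * S"
      unfolding N_def S_def u_def by (rule implicit_step_l1_le[OF \<open>0 < \<tau>\<close> step])
    ultimately have "N\<^sup>2 \<le> (2 * \<tau> * S)\<^sup>2" by (intro power_mono) auto
    also have "\<dots> = 4 * \<tau>\<^sup>2 * S\<^sup>2" by (simp add: power_mult_distrib)
    also have "\<dots> \<le> 4 * \<tau>\<^sup>2 * (sum k E * (B * I))"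
      unfolding S_def I_def by (intro mult_left_mono total_flux_square_le u_pos u_le) auto
    finally have "K * N\<^sup>2 \<le> K * (4 * \<tau>\<^sup>2 * (sum k E * (B * I)))"
      using K_nonneg by (rule mult_left_mono)
    also have "\<dots> = (4 * L * \<tau>) * (\<tau> * I)"
      by (simp add: L_def power2_eq_square)
    also have "\<dots> \<le> 1 * (\<tau> * I)"
      using small I_nonneg \<open>0 < \<tau>\<close> by (intro mult_right_mono) auto
    finally have "K * N\<^sup>2 \<le> \<tau> * I" by simp
    moreover have "(\<Sum>p\<in>P. w p * potential W (\<lambda>q. \<rho>' q - \<rho> q) p * (\<rho>' p - \<rho> p)) \<le> K * N\<^sup>2"
      unfolding N_def by (rule interaction_le_l1[OF W_le])
    moreover have "energy V W \<rho>' - energy V W \<rho> \<le> - \<tau> * I +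
        1 / 2 * (\<Sum>p\<in>P. w p * potential W (\<lambda>q. \<rho>' q - \<rho> q) p * (\<rho>' p - \<rho> p))"
      unfolding I_def u_def by (rule energy_step_le[OF M W step \<rho> \<rho>'_pos])
    ultimately have "energy V W \<rho>' - energy V W \<rho> \<le> - (\<tau> / 2) * I" by simp
    thus "energy V W \<rho>' - energy V W \<rho> \<le>
             - (\<tau> / 2) * dirichlet (\<lambda>p. \<rho>' p / M p) (\<lambda>p. ln (\<rho>' p / M p)) \<and>
           0 \<le> dirichlet (\<lambda>p. \<rho>' p / M p) (\<lambda>p. ln (\<rho>' p / M p))"
      using I_nonneg by (simp add: I_def u_def)
  qed
qed

end

section \<open>The finite volume scheme as a step on the graph of cells\<close>

lemma summation_by_parts:
  fixes F \<phi> :: "nat \<Rightarrow> real"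
  assumes "1 \<le> N" "F 0 = 0" "F N = 0"
  shows "(\<Sum>i=1..N. (F i - F (i - 1)) * \<phi> i) = - (\<Sum>i=1..<N. F i * (\<phi> (i + 1) - \<phi> i))"
proof -
  have "(\<Sum>i=1..n. (F i - F (i - 1)) * \<phi> i) =
          F n * \<phi> n - (\<Sum>i=1..<n. F i * (\<phi> (i + 1) - \<phi> i))" if "1 \<le> n" for n
    using that
  proof (induction n rule: dec_induct)
    case base
    thus ?case using \<open>F 0 = 0\<close> by simp
  next
    case (step n)
    thus ?case by (simp add: algebra_simps)
  qed
  from this[OF \<open>1 \<le> N\<close>] show ?thesis using \<open>F N = 0\<close> by simp
qed

definition grid_cells :: "mesh \<Rightarrow> (nat \<times> nat) set" where
  "grid_cells m = {1..nx m} \<times> {1..ny m}"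

definition grid_edges :: "mesh \<Rightarrow> ((nat \<times> nat) \<times> (nat \<times> nat)) set" where
  "grid_edges m =
     (\<lambda>(i, j). ((i, j), (i + 1, j))) ` ({1..<nx m} \<times> {1..ny m}) \<union>
     (\<lambda>(i, j). ((i, j), (i, j + 1))) ` ({1..nx m} \<times> {1..<ny m})"

definition cell_area :: "mesh \<Rightarrow> nat \<times> nat \<Rightarrow> real" where
  "cell_area m = (\<lambda>(i, j). hx m i * hy m j)"

text \<open>
  Face length times the mobility at the face over the distance of the adjacent centers. An edge
  that keeps the first index crosses a horizontal face.
\<close>

definition face_conductance :: "mesh \<Rightarrow> (real \<Rightarrow> real \<Rightarrow> real) \<Rightarrow> (real \<Rightarrow> real \<Rightarrow> real) \<Rightarrow>
    grid_fun \<Rightarrow> (nat \<times> nat) \<times> (nat \<times> nat) \<Rightarrow> real" where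
  "face_conductance m V W \<rho> = (\<lambda>((i, j), (i', j')).
     if i' = i then hx m i * (M_yface m V W \<rho> i j / hy_half m j)
     else hy m j * (M_xface m V W \<rho> i j / hx_half m i))"

definition center_potential :: "mesh \<Rightarrow> (real \<Rightarrow> real \<Rightarrow> real) \<Rightarrow> nat \<times> nat \<Rightarrow> real" where
  "center_potential m V = (\<lambda>(i, j). V (xcenter m i) (ycenter m j))"

text \<open>
  The source cell is the first argument, as in the potential of a weighted graph.
\<close>

definition center_kernel ::
    "mesh \<Rightarrow> (real \<Rightarrow> real \<Rightarrow> real) \<Rightarrow> nat \<times> nat \<Rightarrow> nat \<times> nat \<Rightarrow> real" where
  "center_kernel m W = (\<lambda>(k, l) (i, j). W (xcenter m k - xcenter m i) (ycenter m l - ycenter m j))"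

lemma sum_grid_cells:
  "(\<Sum>p\<in>grid_cells m. f p) = (\<Sum>i=1..nx m. \<Sum>j=1..ny m. f (i, j))"
  by (simp add: grid_cells_def sum.cartesian_product)

lemma sum_grid_edges:
  "(\<Sum>e\<in>grid_edges m. f e) =
     (\<Sum>j=1..ny m. \<Sum>i=1..<nx m. f ((i, j), (i + 1, j))) +
     (\<Sum>i=1..nx m. \<Sum>j=1..<ny m. f ((i, j), (i, j + 1)))"
proof -
  have "(\<Sum>e\<in>grid_edges m. f e) =
     (\<Sum>(i, j)\<in>{1..<nx m} \<times> {1..ny m}. f ((i, j), (i + 1, j))) +
     (\<Sum>(i, j)\<in>{1..nx m} \<times> {1..<ny m}. f ((i, j), (i, j + 1)))"
    unfolding grid_edges_def
    by (subst sum.union_disjoint)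
       (auto simp: sum.reindex inj_on_def case_prod_unfold o_def)
  also have "(\<Sum>(i, j)\<in>{1..<nx m} \<times> {1..ny m}. f ((i, j), (i + 1, j))) =
      (\<Sum>j=1..ny m. \<Sum>i=1..<nx m. f ((i, j), (i + 1, j)))"
    unfolding sum.cartesian_product[symmetric] by (rule sum.swap)
  finally show ?thesis by (simp add: sum.cartesian_product)
qed

context
  fixes m :: mesh and a b c d :: real
  assumes mesh: "cartesian_mesh m a b c d"
begin

lemma mesh_size_pos:
  "i \<in> {1..nx m} \<Longrightarrow> 0 < hx m i" "j \<in> {1..ny m} \<Longrightarrow> 0 < hy m j" "1 \<le> nx m" "1 \<le> ny m"
  using mesh by (auto simp: cartesian_mesh_def partition_of_def hx_def hy_def)

lemma mesh_half_size_pos: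
  "1 \<le> i \<Longrightarrow> i < nx m \<Longrightarrow> 0 < hx_half m i" "1 \<le> j \<Longrightarrow> j < ny m \<Longrightarrow> 0 < hy_half m j"
  using mesh_size_pos(1)[of i] mesh_size_pos(1)[of "i + 1"]
    mesh_size_pos(2)[of j] mesh_size_pos(2)[of "j + 1"]
  by (auto simp: hx_half_def hy_half_def)

lemma grid_connected:
  assumes f: "\<And>p q. (p, q) \<in> grid_edges m \<Longrightarrow> f p = f q" and "p \<in> grid_cells m"
  shows "f p = f (1, 1)"
proof -
  have x: "f (i + 1, j) = f (i, j)" if "1 \<le> i" "i < nx m" "1 \<le> j" "j \<le> ny m" for i j
    by (rule f[symmetric]) (use that in \<open>auto simp: grid_edges_def\<close>)
  have y: "f (i, j + 1) = f (i, j)" if "1 \<le> i" "i \<le> nx m" "1 \<le> j" "j < ny m" for i j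
    by (rule f[symmetric]) (use that in \<open>auto simp: grid_edges_def\<close>)
  have fx: "f (i, j) = f (1, j)" if "1 \<le> i" "i \<le> nx m" "1 \<le> j" "j \<le> ny m" for i j
    using that by (induction i rule: dec_induct) (use x in auto)
  have fy: "f (1, j) = f (1, 1)" if "1 \<le> j" "j \<le> ny m" for j
    using that by (induction j rule: dec_induct) (use y mesh_size_pos(3) in auto)
  obtain i j where p: "p = (i, j)" "1 \<le> i" "i \<le> nx m" "1 \<le> j" "j \<le> ny m"
    using \<open>p \<in> grid_cells m\<close> by (auto simp: grid_cells_def)
  show ?thesis
    unfolding p(1) using fx[OF p(2-5)] fy[OF p(4,5)] by (rule trans)
qed

lemma weighted_graph_grid:
  "weighted_graph (grid_cells m) (grid_edges m) (cell_area m) (face_conductance m V W \<rho>)"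
proof
  show "finite (grid_cells m)" by (simp add: grid_cells_def)
  show "grid_edges m \<subseteq> grid_cells m \<times> grid_cells m"
    by (auto simp: grid_cells_def grid_edges_def)
  show "0 < cell_area m p" if "p \<in> grid_cells m" for p
    using that mesh_size_pos by (auto simp: cell_area_def grid_cells_def)
  show "0 < face_conductance m V W \<rho> e" if "e \<in> grid_edges m" for e
    using that mesh_size_pos mesh_half_size_pos
    by (auto simp: face_conductance_def grid_edges_def M_xface_def M_yface_def Q2_def)
  show "f p = f q"
    if "\<And>p q. (p, q) \<in> grid_edges m \<Longrightarrow> f p = f q" "p \<in> grid_cells m" "q \<in> grid_cells m"
    for f :: "nat \<times> nat \<Rightarrow> bool" and p q
    using grid_connected[of f p] grid_connected[of f q] that by blast
qed

lemma dirichlet_grid: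
  "weighted_graph.dirichlet (grid_edges m) (face_conductance m V W \<rho>)
     (\<lambda>p. case_prod \<rho>' p / case_prod (M_cell m V W \<rho>) p) \<phi> =
   (\<Sum>j=1..ny m. \<Sum>i=1..<nx m. hy m j * flux_x m V W \<rho> \<rho>' i j * (\<phi> (i + 1, j) - \<phi> (i, j))) +
   (\<Sum>i=1..nx m. \<Sum>j=1..<ny m. hx m i * flux_y m V W \<rho> \<rho>' i j * (\<phi> (i, j + 1) - \<phi> (i, j)))"
  unfolding weighted_graph.dirichlet_def[OF weighted_graph_grid] sum_grid_edges
  by (intro arg_cong2[of _ _ _ _ "(+)"] sum.cong refl)
     (simp_all add: face_conductance_def flux_x_def flux_y_def mult_ac)

text \<open>
  Multiplying the equation of a cell by its area and by \<open>\<phi>\<close> and summing along rows and columns,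
  the flux differences move onto \<open>\<phi>\<close>; no boundary terms remain because the outer fluxes vanish.
\<close>

lemma implicit_step_grid:
  assumes "0 < \<tau>" and step: "scheme_step m V W \<tau> \<rho> \<rho>'"
  shows "weighted_graph.implicit_step (grid_cells m) (grid_edges m) (cell_area m)
           (face_conductance m V W \<rho>) (case_prod (M_cell m V W \<rho>)) \<tau>
           (case_prod \<rho>) (case_prod \<rho>')"
  unfolding weighted_graph.implicit_step_def[OF weighted_graph_grid] dirichlet_grid sum_grid_cells
proof
  fix \<phi> :: "nat \<times> nat \<Rightarrow> real"
  define F where "F = flux_x m V W \<rho> \<rho>'"
  define G where "G = flux_y m V W \<rho> \<rho>'"
  have parts_x: "(\<Sum>i=1..nx m. (F i j - F (i - 1) j) * \<phi> (i, j)) =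
      - (\<Sum>i=1..<nx m. F i j * (\<phi> (i + 1, j) - \<phi> (i, j)))" for j
    using mesh_size_pos(3) by (intro summation_by_parts) (auto simp: F_def flux_x_def)
  have parts_y: "(\<Sum>j=1..ny m. (G i j - G i (j - 1)) * \<phi> (i, j)) =
      - (\<Sum>j=1..<ny m. G i j * (\<phi> (i, j + 1) - \<phi> (i, j)))" for i
    using mesh_size_pos(4) by (intro summation_by_parts) (auto simp: G_def flux_y_def)
  have "(\<Sum>i=1..nx m. \<Sum>j=1..ny m. cell_area m (i, j) * (\<rho>' i j - \<rho> i j) * \<phi> (i, j)) =
      (\<Sum>i=1..nx m. \<Sum>j=1..ny m. \<tau> * (hy m j * ((F i j - F (i - 1) j) * \<phi> (i, j))) +
        \<tau> * (hx m i * ((G i j - G i (j - 1)) * \<phi> (i, j))))"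
  proof (intro sum.cong refl)
    fix i j assume ij: "i \<in> {1..nx m}" "j \<in> {1..ny m}"
    have "(\<rho>' i j - \<rho> i j) / \<tau> =
        (F i j - F (i - 1) j) / hx m i + (G i j - G i (j - 1)) / hy m j"
      using step ij unfolding scheme_step_def F_def G_def by blast
    hence "\<rho>' i j - \<rho> i j =
        \<tau> * ((F i j - F (i - 1) j) / hx m i + (G i j - G i (j - 1)) / hy m j)"
      using \<open>0 < \<tau>\<close> by (simp add: field_simps)
    thus "cell_area m (i, j) * (\<rho>' i j - \<rho> i j) * \<phi> (i, j) =
        \<tau> * (hy m j * ((F i j - F (i - 1) j) * \<phi> (i, j))) +
        \<tau> * (hx m i * ((G i j - G i (j - 1)) * \<phi> (i, j)))"
      using mesh_size_pos(1)[OF ij(1)] mesh_size_pos(2)[OF ij(2)]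
      by (simp add: cell_area_def distrib_left distrib_right)
  qed
  also have "\<dots> = \<tau> * (\<Sum>i=1..nx m. \<Sum>j=1..ny m. hy m j * ((F i j - F (i - 1) j) * \<phi> (i, j))) +
      \<tau> * (\<Sum>i=1..nx m. \<Sum>j=1..ny m. hx m i * ((G i j - G i (j - 1)) * \<phi> (i, j)))"
    by (simp only: sum.distrib sum_distrib_left)
  also have "(\<Sum>i=1..nx m. \<Sum>j=1..ny m. hy m j * ((F i j - F (i - 1) j) * \<phi> (i, j))) =
      (\<Sum>j=1..ny m. hy m j * (\<Sum>i=1..nx m. (F i j - F (i - 1) j) * \<phi> (i, j)))"
    unfolding sum_distrib_left by (rule sum.swap)
  also have "\<dots> = - (\<Sum>j=1..ny m. \<Sum>i=1..<nx m. hy m j * F i j * (\<phi> (i + 1, j) - \<phi> (i, j)))"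
    by (simp only: parts_x mult_minus_right sum_negf sum_distrib_left mult.assoc)
  also have "(\<Sum>i=1..nx m. \<Sum>j=1..ny m. hx m i * ((G i j - G i (j - 1)) * \<phi> (i, j))) =
      (\<Sum>i=1..nx m. hx m i * (\<Sum>j=1..ny m. (G i j - G i (j - 1)) * \<phi> (i, j)))"
    unfolding sum_distrib_left ..
  also have "\<dots> = - (\<Sum>i=1..nx m. \<Sum>j=1..<ny m. hx m i * G i j * (\<phi> (i, j + 1) - \<phi> (i, j)))"
    by (simp only: parts_y mult_minus_right sum_negf sum_distrib_left mult.assoc)
  finally show "(\<Sum>i=1..nx m. \<Sum>j=1..ny m.
        cell_area m (i, j) * (case_prod \<rho>' (i, j) - case_prod \<rho> (i, j)) * \<phi> (i, j)) =
      - \<tau> * ((\<Sum>j=1..ny m. \<Sum>i=1..<nx m.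
          hy m j * flux_x m V W \<rho> \<rho>' i j * (\<phi> (i + 1, j) - \<phi> (i, j))) +
        (\<Sum>i=1..nx m. \<Sum>j=1..<ny m.
          hx m i * flux_y m V W \<rho> \<rho>' i j * (\<phi> (i, j + 1) - \<phi> (i, j))))"
    by (simp add: F_def G_def algebra_simps)
qed

lemma potential_grid:
  "weighted_graph.potential (grid_cells m) (cell_area m) (center_kernel m W) (case_prod \<rho>) (i, j) =
     interaction m W \<rho> i j"
  unfolding weighted_graph.potential_def[OF weighted_graph_grid] sum_grid_cells
  by (simp add: interaction_def cell_area_def center_kernel_def)

lemma M_cell_eq_exp:
  "case_prod (M_cell m V W \<rho>) p = exp (- center_potential m V p -
     weighted_graph.potential (grid_cells m) (cell_area m) (center_kernel m W) (case_prod \<rho>) p)"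
  by (cases p) (simp add: potential_grid M_cell_def Q2_def interaction_def center_potential_def)

lemma energy_grid:
  "weighted_graph.energy (grid_cells m) (cell_area m) (center_potential m V) (center_kernel m W)
     (case_prod \<rho>) = free_energy m V W \<rho>"
  unfolding weighted_graph.energy_def[OF weighted_graph_grid] sum_grid_cells potential_grid
  by (simp add: free_energy_def cell_area_def center_potential_def)

lemma dissipation_grid:
  "weighted_graph.dirichlet (grid_edges m) (face_conductance m V W \<rho>)
     (\<lambda>p. case_prod \<rho>' p / case_prod (M_cell m V W \<rho>) p)
     (\<lambda>p. ln (case_prod \<rho>' p / case_prod (M_cell m V W \<rho>) p)) = dissipation m V W \<rho> \<rho>'"
  unfolding dirichlet_grid by (simp add: dissipation_def)

lemma mass_grid:
  "weighted_graph.mass (grid_cells m) (cell_area m) (case_prod \<rho>) =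
     (\<Sum>i=1..nx m. \<Sum>j=1..ny m. hx m i * hy m j * \<rho> i j)"
  unfolding weighted_graph.mass_def[OF weighted_graph_grid] sum_grid_cells
  by (simp add: cell_area_def)

end

section \<open>Integrals over the cells of a partition\<close>

lemma partition_strict_mono:
  assumes "partition_of a b N p" "i < j" "j \<le> N"
  shows "p i < p j"
  using \<open>i < j\<close> \<open>j \<le> N\<close>
proof (induction j)
  case (Suc j)
  have "p (Suc j - 1) < p (Suc j)"
    using assms(1) Suc.prems unfolding partition_of_def by (metis atLeastAtMost_iff le_add1 plus_1_eq_Suc)
  hence "p j < p (Suc j)" by simp
  thus ?case using Suc by (cases "i = j") auto
qed simp

lemma partition_interval_cover:
  assumes "partition_of a b N p"
  shows "{a..b} = (\<Union>i\<in>{1..N}. {p (i - 1)..p i})"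
proof -
  have le: "p i \<le> p j" if "i \<le> j" "j \<le> N" for i j
    using partition_strict_mono[OF assms, of i j] that by (cases "i = j") auto
  have "x \<in> (\<Union>i\<in>{1..n}. {p (i - 1)..p i})" if "1 \<le> n" "p 0 \<le> x" "x \<le> p n" for n x
    using that
  proof (induction n rule: dec_induct)
    case (step n)
    show ?case
    proof (cases "x \<le> p n")
      case True
      with step obtain i where "i \<in> {1..n}" "x \<in> {p (i - 1)..p i}" by blast
      thus ?thesis by (intro UN_I[of i]) auto
    next
      case False
      with step show ?thesis by (intro UN_I[of "Suc n"]) auto
    qed
  qed auto
  moreover have "x \<in> {p 0..p N}" if "i \<in> {1..N}" "x \<in> {p (i - 1)..p i}" for i x
    using that le[of 0 "i - 1"] le[of i N] by fastforce
  ultimately show ?thesis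
    using assms unfolding partition_of_def by auto
qed

lemma partition_interval_overlap:
  assumes "partition_of a b N p" "i \<in> {1..N}" "j \<in> {1..N}" "i \<noteq> j"
    and "x \<in> {p (i - 1)..p i}" "x \<in> {p (j - 1)..p j}"
  shows "x \<in> p ` {0..N}"
proof -
  have "x = p i" if "i < j" "j \<le> N" "x \<le> p i" "p (j - 1) \<le> x" for i j
  proof (cases "i = j - 1")
    case False
    with that have "i < j - 1" "j - 1 \<le> N" by auto
    thus ?thesis using partition_strict_mono[OF assms(1)] that by fastforce
  qed (use that in auto)
  from this[of i j] this[of j i] show ?thesis
    using assms(2-) by (cases "i < j") auto
qed

lemma AE_not_on_lines:
  fixes A B :: "real set"
  assumes "finite A" "finite B"
  shows "AE z in lebesgue. fst (z :: real \<times> real) \<notin> A \<and> snd z \<notin> B"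
proof -
  have x: "AE z in lebesgue. fst (z :: real \<times> real) \<noteq> s" for s
  proof -
    have "negligible {z :: real \<times> real. z \<bullet> (1, 0) = s}"
      by (rule negligible_standard_hyperplane) (simp add: Basis_prod_def)
    hence "{z :: real \<times> real. fst z = s} \<in> null_sets lebesgue"
      by (simp add: negligible_iff_null_sets inner_prod_def)
    thus ?thesis by (rule AE_I') auto
  qed
  have y: "AE z in lebesgue. snd (z :: real \<times> real) \<noteq> s" for s
  proof -
    have "negligible {z :: real \<times> real. z \<bullet> (0, 1) = s}"
      by (rule negligible_standard_hyperplane) (simp add: Basis_prod_def)
    hence "{z :: real \<times> real. snd z = s} \<in> null_sets lebesgue"
      by (simp add: negligible_iff_null_sets inner_prod_def)
    thus ?thesis by (rule AE_I') auto
  qed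
  have "AE z in lebesgue. (\<forall>s\<in>A. fst (z :: real \<times> real) \<noteq> s)"
    using x by (intro AE_finite_allI \<open>finite A\<close>)
  moreover have "AE z in lebesgue. (\<forall>s\<in>B. snd (z :: real \<times> real) \<noteq> s)"
    using y by (intro AE_finite_allI \<open>finite B\<close>)
  ultimately show ?thesis by eventually_elim auto
qed

text \<open>
  Closed cells overlap, but only on the finitely many mesh lines, which form a null set.
\<close>

lemma integral_eq_sum_cells:
  fixes f :: "real \<times> real \<Rightarrow> real"
  assumes mesh: "cartesian_mesh m a b c d"
    and f: "set_integrable lebesgue ({a..b} \<times> {c..d}) f"
  shows "(LINT z:{a..b} \<times> {c..d}|lebesgue. f z) =
           (\<Sum>i=1..nx m. \<Sum>j=1..ny m. LINT z:cell m i j|lebesgue. f z)"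
proof -
  have px: "partition_of a b (nx m) (xface m)" and py: "partition_of c d (ny m) (yface m)"
    using mesh by (auto simp: cartesian_mesh_def)
  have cover: "{a..b} \<times> {c..d} = (\<Union>p\<in>grid_cells m. case_prod (cell m) p)"
    unfolding partition_interval_cover[OF px] partition_interval_cover[OF py]
    by (auto simp: grid_cells_def cell_def)
  have meas: "case_prod (cell m) p \<in> sets lebesgue" for p
  proof -
    have "case_prod (cell m) p \<in> sets borel"
      unfolding cell_def case_prod_unfold by (intro borel_closed closed_Times) auto
    thus ?thesis by simp
  qed
  have "(LINT z:(\<Union>p\<in>grid_cells m. case_prod (cell m) p)|lebesgue. f z) =
          (\<Sum>p\<in>grid_cells m. LINT z:case_prod (cell m) p|lebesgue. f z)"
  proof (rule set_integral_finite_UN_AE)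
    show "finite (grid_cells m)" by (simp add: grid_cells_def)
  next
    fix p q assume p: "p \<in> grid_cells m" and q: "q \<in> grid_cells m"
    have "AE z in lebesgue. fst z \<notin> xface m ` {0..nx m} \<and> snd z \<notin> yface m ` {0..ny m}"
      by (rule AE_not_on_lines) auto
    thus "AE z in lebesgue. z \<in> case_prod (cell m) p \<and> z \<in> case_prod (cell m) q \<longrightarrow> p = q"
    proof eventually_elim
      case (elim z)
      show ?case
      proof (intro impI prod_eqI; rule ccontr)
        assume z: "z \<in> case_prod (cell m) p \<and> z \<in> case_prod (cell m) q"
        { assume "fst p \<noteq> fst q"
          hence "fst z \<in> xface m ` {0..nx m}"
            using p q z by (intro partition_interval_overlap[OF px, of "fst p" "fst q"])
              (auto simp: grid_cells_def cell_def)
          thus False using elim by simp }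
        { assume "snd p \<noteq> snd q"
          hence "snd z \<in> yface m ` {0..ny m}"
            using p q z by (intro partition_interval_overlap[OF py, of "snd p" "snd q"])
              (auto simp: grid_cells_def cell_def)
          thus False using elim by simp }
      qed
    qed
  next
    show "case_prod (cell m) p \<in> sets lebesgue" for p by (rule meas)
  next
    fix p assume "p \<in> grid_cells m"
    thus "set_integrable lebesgue (case_prod (cell m) p) f"
      using cover by (intro set_integrable_subset[OF f meas]) blast
  qed
  thus ?thesis by (simp add: cover sum_grid_cells)
qed

section \<open>Mass, positivity and entropy for the scheme\<close>

lemma scheme_mass:
  assumes mesh: "cartesian_mesh m a b c d" and "0 < \<tau>"
    and int: "set_integrable lebesgue ({a..b} \<times> {c..d}) \<rho>\<^sub>0"
    and init: "\<And>i j. \<lbrakk>i \<in> {1..nx m}; j \<in> {1..ny m}\<rbrakk> \<Longrightarrow>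
           \<rho> 0 i j = 1 / (hx m i * hy m j) * (LINT z:cell m i j|lebesgue. \<rho>\<^sub>0 z)"
    and step: "\<And>n. scheme_step m V W \<tau> (\<rho> n) (\<rho> (Suc n))"
  shows "(\<Sum>i=1..nx m. \<Sum>j=1..ny m. hx m i * hy m j * \<rho> n i j) =
           (LINT z:{a..b} \<times> {c..d}|lebesgue. \<rho>\<^sub>0 z)"
proof (induction n)
  case 0
  have "(\<Sum>i=1..nx m. \<Sum>j=1..ny m. hx m i * hy m j * \<rho> 0 i j) =
          (\<Sum>i=1..nx m. \<Sum>j=1..ny m. LINT z:cell m i j|lebesgue. \<rho>\<^sub>0 z)"
  proof (intro sum.cong refl)
    fix i j assume ij: "i \<in> {1..nx m}" "j \<in> {1..ny m}"
    show "hx m i * hy m j * \<rho> 0 i j = (LINT z:cell m i j|lebesgue. \<rho>\<^sub>0 z)"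
      using mesh_size_pos(1)[OF mesh ij(1)] mesh_size_pos(2)[OF mesh ij(2)]
      by (simp add: init[OF ij])
  qed
  thus ?case using integral_eq_sum_cells[OF mesh int] by simp
next
  case (Suc n)
  show ?case
    using weighted_graph.mass_conserved[OF weighted_graph_grid[OF mesh]
        implicit_step_grid[OF mesh \<open>0 < \<tau>\<close> step[of n]]] Suc
    by (simp add: mass_grid[OF mesh])
qed

lemma scheme_nonneg:
  assumes mesh: "cartesian_mesh m a b c d" and "0 < \<tau>"
    and step: "scheme_step m V W \<tau> \<rho> \<rho>'"
    and \<rho>: "\<And>i j. \<lbrakk>i \<in> {1..nx m}; j \<in> {1..ny m}\<rbrakk> \<Longrightarrow> 0 \<le> \<rho> i j"
    and ij: "i \<in> {1..nx m}" "j \<in> {1..ny m}"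
  shows "0 \<le> \<rho>' i j"
proof -
  have "0 \<le> case_prod \<rho>' (i, j)"
    by (rule weighted_graph.implicit_step_nonneg[OF weighted_graph_grid[OF mesh] _ \<open>0 < \<tau>\<close>
          implicit_step_grid[OF mesh \<open>0 < \<tau>\<close> step]])
       (use \<rho> ij in \<open>auto simp: grid_cells_def M_cell_def Q2_def\<close>)
  thus ?thesis by simp
qed

lemma scheme_entropy_dissipation:
  assumes mesh: "cartesian_mesh m a b c d" and W_even: "\<And>x y. W x y = W (- x) (- y)"
    and \<rho>: "\<And>i j. \<lbrakk>i \<in> {1..nx m}; j \<in> {1..ny m}\<rbrakk> \<Longrightarrow> 0 \<le> \<rho> i j"
    and ne: "\<exists>i\<in>{1..nx m}. \<exists>j\<in>{1..ny m}. \<rho> i j \<noteq> 0"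
  shows "\<exists>\<tau>\<^sub>s>0. \<forall>\<tau>\<in>{0<..<\<tau>\<^sub>s}. \<forall>\<rho>'. scheme_step m V W \<tau> \<rho> \<rho>' \<longrightarrow>
           free_energy m V W \<rho>' - free_energy m V W \<rho> \<le> - (\<tau> / 2) * dissipation m V W \<rho> \<rho>' \<and>
           dissipation m V W \<rho> \<rho>' \<ge> 0"
proof -
  interpret weighted_graph "grid_cells m" "grid_edges m" "cell_area m" "face_conductance m V W \<rho>"
    by (rule weighted_graph_grid[OF mesh])
  have W_sym: "center_kernel m W p q = center_kernel m W q p" for p q
  proof -
    have "W (xcenter m k - xcenter m i) (ycenter m l - ycenter m j) =
          W (xcenter m i - xcenter m k) (ycenter m j - ycenter m l)" for i j k l
      by (subst W_even) simp
    thus ?thesis by (simp add: center_kernel_def case_prod_unfold)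
  qed
  have nonneg: "0 \<le> case_prod \<rho> p" if "p \<in> grid_cells m" for p
    using that \<rho> by (auto simp: grid_cells_def)
  have nonzero: "\<exists>p\<in>grid_cells m. case_prod \<rho> p \<noteq> 0"
    using ne by (force simp: grid_cells_def)
  obtain \<tau>\<^sub>s where "0 < \<tau>\<^sub>s" and diss: "\<And>\<tau> f.
      \<lbrakk>0 < \<tau>; \<tau> < \<tau>\<^sub>s; implicit_step (case_prod (M_cell m V W \<rho>)) \<tau> (case_prod \<rho>) f\<rbrakk> \<Longrightarrow>
        energy (center_potential m V) (center_kernel m W) f -
        energy (center_potential m V) (center_kernel m W) (case_prod \<rho>) \<le>
          - (\<tau> / 2) * dirichlet (\<lambda>p. f p / case_prod (M_cell m V W \<rho>) p)
                                (\<lambda>p. ln (f p / case_prod (M_cell m V W \<rho>) p)) \<and>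
        0 \<le> dirichlet (\<lambda>p. f p / case_prod (M_cell m V W \<rho>) p)
                      (\<lambda>p. ln (f p / case_prod (M_cell m V W \<rho>) p))"
    by (rule energy_dissipation[OF M_cell_eq_exp[OF mesh, where V = V] W_sym nonneg nonzero]) blast+
  show ?thesis
  proof (intro exI[of _ \<tau>\<^sub>s] conjI \<open>0 < \<tau>\<^sub>s\<close> ballI allI impI)
    fix \<tau> \<rho>' assume \<tau>: "\<tau> \<in> {0<..<\<tau>\<^sub>s}" and step: "scheme_step m V W \<tau> \<rho> \<rho>'"
    have "implicit_step (case_prod (M_cell m V W \<rho>)) \<tau> (case_prod \<rho>) (case_prod \<rho>')"
      using \<tau> step by (intro implicit_step_grid[OF mesh]) auto
    from diss[OF _ _ this] \<tau>
    show "free_energy m V W \<rho>' - free_energy m V W \<rho> \<le> - (\<tau> / 2) * dissipation m V W \<rho> \<rho>'"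
      and "dissipation m V W \<rho> \<rho>' \<ge> 0"
      unfolding energy_grid[OF mesh] dissipation_grid[OF mesh] by auto
  qed
qed

theorem theorem4p2:
  fixes V W :: "real \<Rightarrow> real \<Rightarrow> real" and m :: mesh and a b c d :: real
  assumes W_even: "\<And>x y. W x y = W (- x) (- y)"
    and mesh: "cartesian_mesh m a b c d"
  shows
    "(\<forall>\<tau>>0. \<forall>(\<rho>\<^sub>0 :: real \<times> real \<Rightarrow> real) (\<rho> :: nat \<Rightarrow> grid_fun).
        set_integrable lebesgue ({a..b} \<times> {c..d}) \<rho>\<^sub>0 \<longrightarrow>
        (\<forall>i\<in>{1..nx m}. \<forall>j\<in>{1..ny m}.
           \<rho> 0 i j = 1 / (hx m i * hy m j) * (LINT z:cell m i j|lebesgue. \<rho>\<^sub>0 z)) \<longrightarrow>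
        (\<forall>n. scheme_step m V W \<tau> (\<rho> n) (\<rho> (Suc n))) \<longrightarrow>
        (\<forall>n\<ge>1. (\<Sum>i=1..nx m. \<Sum>j=1..ny m. hx m i * hy m j * \<rho> n i j) =
                 (LINT z:{a..b} \<times> {c..d}|lebesgue. \<rho>\<^sub>0 z))) \<and>
     (\<forall>\<tau>>0. \<forall>\<rho> \<rho>'.
        scheme_step m V W \<tau> \<rho> \<rho>' \<longrightarrow>
        (\<forall>i\<in>{1..nx m}. \<forall>j\<in>{1..ny m}. \<rho> i j \<ge> 0) \<longrightarrow>
        (\<forall>i\<in>{1..nx m}. \<forall>j\<in>{1..ny m}. \<rho>' i j \<ge> 0)) \<and>
     (\<forall>\<rho>.
        (\<forall>i\<in>{1..nx m}. \<forall>j\<in>{1..ny m}. \<rho> i j \<ge> 0) \<longrightarrow>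
        (\<exists>i\<in>{1..nx m}. \<exists>j\<in>{1..ny m}. \<rho> i j \<noteq> 0) \<longrightarrow>
        (\<exists>\<tau>\<^sub>s>0. \<forall>\<tau>\<in>{0<..<\<tau>\<^sub>s}. \<forall>\<rho>'.
           scheme_step m V W \<tau> \<rho> \<rho>' \<longrightarrow>
           free_energy m V W \<rho>' - free_energy m V W \<rho> \<le> - (\<tau> / 2) * dissipation m V W \<rho> \<rho>' \<and>
           dissipation m V W \<rho> \<rho>' \<ge> 0))"
proof (intro conjI allI impI ballI)
  fix \<tau> :: real and \<rho>\<^sub>0 :: "real \<times> real \<Rightarrow> real" and \<rho> :: "nat \<Rightarrow> grid_fun" and n :: nat
  assume "0 < \<tau>" and int: "set_integrable lebesgue ({a..b} \<times> {c..d}) \<rho>\<^sub>0"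
    and init: "\<forall>i\<in>{1..nx m}. \<forall>j\<in>{1..ny m}.
       \<rho> 0 i j = 1 / (hx m i * hy m j) * (LINT z:cell m i j|lebesgue. \<rho>\<^sub>0 z)"
    and step: "\<forall>n. scheme_step m V W \<tau> (\<rho> n) (\<rho> (Suc n))"
  show "(\<Sum>i=1..nx m. \<Sum>j=1..ny m. hx m i * hy m j * \<rho> n i j) =
          (LINT z:{a..b} \<times> {c..d}|lebesgue. \<rho>\<^sub>0 z)"
    by (rule scheme_mass[OF mesh \<open>0 < \<tau>\<close> int]) (use init step in blast)+
next
  fix \<tau> :: real and \<rho> \<rho>' :: grid_fun and i j
  assume "0 < \<tau>" and step: "scheme_step m V W \<tau> \<rho> \<rho>'"
    and \<rho>: "\<forall>i\<in>{1..nx m}. \<forall>j\<in>{1..ny m}. \<rho> i j \<ge> 0"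
    and ij: "i \<in> {1..nx m}" "j \<in> {1..ny m}"
  show "\<rho>' i j \<ge> 0"
    by (rule scheme_nonneg[OF mesh \<open>0 < \<tau>\<close> step _ ij]) (use \<rho> in blast)
next
  fix \<rho> :: grid_fun
  assume \<rho>: "\<forall>i\<in>{1..nx m}. \<forall>j\<in>{1..ny m}. \<rho> i j \<ge> 0"
    and ne: "\<exists>i\<in>{1..nx m}. \<exists>j\<in>{1..ny m}. \<rho> i j \<noteq> 0"
  show "\<exists>\<tau>\<^sub>s>0. \<forall>\<tau>\<in>{0<..<\<tau>\<^sub>s}. \<forall>\<rho>'.
           scheme_step m V W \<tau> \<rho> \<rho>' \<longrightarrow>
           free_energy m V W \<rho>' - free_energy m V W \<rho> \<le> - (\<tau> / 2) * dissipation m V W \<rho> \<rho>' \<and>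
           dissipation m V W \<rho> \<rho>' \<ge> 0"
    by (rule scheme_entropy_dissipation[where W = W, OF mesh W_even _ ne]) (use \<rho> in blast)
qed

end
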